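(* Let $I(\boldsymbol{B},\boldsymbol{r})$ be a diagonal blockwise determinantal ideal with $\boldsymbol{B}=(B_1,\dots,B_k)$, $\boldsymbol{r}=(r_1,\dots,r_k)$, and suppose that its generating set $\mathcal{G}$ (the set of all $r_i$-minors in $B_i$ for all $i$) is a Gröbner basis with respect to a diagonal term order. If for each $\boldsymbol{m}\in\mathcal{G}$ we have $\#R(\boldsymbol{m}\cap\tilde B)<\tilde r$ or $\#C(\boldsymbol{m}\cap\tilde B)<\tilde r$ for every block $\tilde B\in\boldsymbol{B}\setminus\boldsymbol{B}_{\boldsymbol{m}}$, where $\tilde r$ is the size of the minors in $\tilde B$ and $\boldsymbol{B}_{\boldsymbol{m}}=\{B_i: r_i=\deg(\boldsymbol{m})\}$, then $\mathcal{G}$ is the reduced Gröbner basis of $I(\boldsymbol{B},\boldsymbol{r})$.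
   Context: Let $K$ be a field and $X=(x_{ij})$ a generic $m\times n$ matrix ($m\le n$) of distinct variables; $K[\boldsymbol{x}]$ is the polynomial ring in all $mn$ variables. A subset of $X$ means a set of entries. An $r$-minor of $X$ is the determinant of an $r\times r$ submatrix (arbitrary row and column index sets of size $r$), regarded as a polynomial; it is a minor in a subset $B$ if all entries of the submatrix belong to $B$. A term order is diagonal if the leading term of every minor of $X$ is the product of the diagonal entries of the corresponding submatrix. A non-empty subset $B$ of $X$ is diagonal if whenever $x_{pq},x_{\tilde p\tilde q}\in B$ with $p\le\tilde p$, $q\le\tilde q$, all $x_{ij}$ with $p\le i\le\tilde p$, $q\le j\le\tilde q$ belong to $B$. For a sequence $\boldsymbol{B}=(B_1,\dots,B_k)$ of non-empty subsets of $X$ (blocks) and a sequence $\boldsymbol{r}=(r_1,\dots,r_k)$ of positive integers, the blockwise determinantal ideal $I(\boldsymbol{B},\boldsymbol{r})\subseteq K[\boldsymbol{x}]$ is generated by all $r_i$-minors in $B_i$ for all $i$; it is diagonal when all blocks are diagonal. Blocks are understood together with their associated minor sizes, so $\boldsymbol{B}\setminus\boldsymbol{B}_{\boldsymbol{m}}$ consists of the $B_j$ with $r_j\ne\deg(\boldsymbol{m})$. For a minor $\boldsymbol{m}$ and a block $\tilde B$, $\boldsymbol{m}\cap\tilde B$ is the set of entries of the submatrix of $\boldsymbol{m}$ lying in $\tilde B$; $R(\boldsymbol{m}\cap\tilde B)$ (resp. $C(\boldsymbol{m}\cap\tilde B)$) is the set of row (resp. column) indices of the entries in $\boldsymbol{m}\cap\tilde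 B$. A Gröbner basis $\mathcal{G}$ is reduced if for each $G\in\mathcal{G}$ no term of $G$ is divisible by the leading term of an element of $\mathcal{G}\setminus\{G\}$, and the leading coefficient of $G$ is $\pm1$ (unique up to signs). *)

theory Defs
  imports
    "HOL-Library.Cardinality"
    "HOL-Library.Poly_Mapping"
    "Jordan_Normal_Form.Determinant"
begin

section \<open>Polynomials, term orders and Groebner bases\<close>

type_synonym 'v mon = "'v \<Rightarrow>\<^sub>0 nat"
type_synonym ('v, 'k) mpol = "'v mon \<Rightarrow>\<^sub>0 'k"

definition Var :: "'v \<Rightarrow> ('v, 'k::field) mpol" where
  "Var v = Poly_Mapping.single (Poly_Mapping.single v 1) 1"

definition total_deg :: "('v, 'k::field) mpol \<Rightarrow> nat" where
  "total_deg p = Max (insert 0 ((\<lambda>t. \<Sum>v\<in>Poly_Mapping.keys t. Poly_Mapping.lookup t v) ` Poly_Mapping.keys p))"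

text \<open>The ring is viewed as a module over itself, so spans are ideals.\<close>

definition ideal_gen :: "('v, 'k::field) mpol set \<Rightarrow> ('v, 'k) mpol set" where
  "ideal_gen G = module.span (*) G"

definition term_order :: "('v mon \<Rightarrow> 'v mon \<Rightarrow> bool) \<Rightarrow> bool" where
  "term_order tord \<longleftrightarrow>
     class.linorder tord (\<lambda>s t. tord s t \<and> \<not> tord t s) \<and>
     (\<forall>t. tord 0 t) \<and>
     (\<forall>s t u. tord s t \<longrightarrow> tord (s + u) (t + u))"

definition lead_mon :: "('v mon \<Rightarrow> 'v mon \<Rightarrow> bool) \<Rightarrow> ('v, 'k::field) mpol \<Rightarrow> 'v mon" where
  "lead_mon tord p = (THE t. t \<in> Poly_Mapping.keys p \<and> (\<forall>s\<in>Poly_Mapping.keys p. tord s t))"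

definition lead_coef :: "('v mon \<Rightarrow> 'v mon \<Rightarrow> bool) \<Rightarrow> ('v, 'k::field) mpol \<Rightarrow> 'k" where
  "lead_coef tord p = Poly_Mapping.lookup p (lead_mon tord p)"

text \<open>Terms carry their coefficients. The leading monomial of 0 is unspecified,
  but its leading term is always 0.\<close>

definition lead_term :: "('v mon \<Rightarrow> 'v mon \<Rightarrow> bool) \<Rightarrow> ('v, 'k::field) mpol \<Rightarrow> ('v, 'k) mpol" where
  "lead_term tord p = Poly_Mapping.single (lead_mon tord p) (lead_coef tord p)"

definition terms_of :: "('v, 'k::field) mpol \<Rightarrow> ('v, 'k) mpol set" where
  "terms_of p = (\<lambda>t. Poly_Mapping.single t (Poly_Mapping.lookup p t)) ` Poly_Mapping.keys p"

definition groebner_basis ::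
  "('v mon \<Rightarrow> 'v mon \<Rightarrow> bool) \<Rightarrow> ('v, 'k::field) mpol set \<Rightarrow> ('v, 'k) mpol set \<Rightarrow> bool" where
  "groebner_basis tord G I \<longleftrightarrow>
     finite G \<and> G \<subseteq> I \<and> ideal_gen (lead_term tord ` G) = ideal_gen (lead_term tord ` I)"

text \<open>Leading coefficients are only required to be 1 or -1, so a reduced Groebner basis is
  unique up to signs.\<close>

definition reduced_groebner_basis ::
  "('v mon \<Rightarrow> 'v mon \<Rightarrow> bool) \<Rightarrow> ('v, 'k::field) mpol set \<Rightarrow> ('v, 'k) mpol set \<Rightarrow> bool" where
  "reduced_groebner_basis tord G I \<longleftrightarrow>
     groebner_basis tord G I \<and>
     (\<forall>g\<in>G. (\<forall>t\<in>terms_of g. \<forall>h\<in>G - {g}. \<not> lead_term tord h dvd t) \<and>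
             (lead_coef tord g = 1 \<or> lead_coef tord g = - 1))"

section \<open>Blockwise determinantal ideals\<close>

text \<open>The generic matrix has rows indexed by \<open>'m\<close> and columns by \<open>'n\<close>, two finite linear
  orders; a subset of its entries is a set of positions, and its entry at a position is the
  corresponding variable. A submatrix is given by its row set and its column set.\<close>

text \<open>The determinant of the submatrix with rows \<open>R\<close> and columns \<open>C\<close>, both taken in increasing
  order; only meaningful if \<open>card R = card C\<close>.\<close>

definition minor :: "'m::{finite,linorder} set \<Rightarrow> 'n::{finite,linorder} set \<Rightarrow> ('m \<times> 'n, 'k::field) mpol" where
  "minor R C = det (mat (card R) (card C)
     (\<lambda>(i, j). Var (sorted_list_of_set R ! i, sorted_list_of_set C ! j)))"

text \<open>The type argument fixes the coefficient field of the minors.\<close>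

definition diagonal_term_order ::
  "'k::field itself \<Rightarrow> (('m::{finite,linorder} \<times> 'n::{finite,linorder}) mon \<Rightarrow> ('m \<times> 'n) mon \<Rightarrow> bool) \<Rightarrow> bool" where
  "diagonal_term_order _ tord \<longleftrightarrow>
     term_order tord \<and>
     (\<forall>R C. card R = card C \<longrightarrow>
        lead_term tord (minor R C :: ('m \<times> 'n, 'k) mpol) =
          (\<Prod>i<card R. Var (sorted_list_of_set R ! i, sorted_list_of_set C ! i)))"

definition diagonal_subset :: "('m::linorder \<times> 'n::linorder) set \<Rightarrow> bool" where
  "diagonal_subset B \<longleftrightarrow>
     B \<noteq> {} \<and>
     (\<forall>p q p' q'. (p, q) \<in> B \<and> (p', q') \<in> B \<and> p \<le> p' \<and> q \<le> q' \<longrightarrow> {p..p'} \<times> {q..q'} \<subseteq> B)"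

definition minors_in :: "nat \<Rightarrow> ('m::{finite,linorder} \<times> 'n::{finite,linorder}) set \<Rightarrow> ('m \<times> 'n, 'k::field) mpol set" where
  "minors_in r B = {minor R C | R C. card R = r \<and> card C = r \<and> R \<times> C \<subseteq> B}"

text \<open>The blocks \<open>B i\<close> and the minor sizes \<open>r i\<close> are indexed by \<open>1 \<le> i \<le> k\<close>.\<close>

definition block_minors ::
  "nat \<Rightarrow> (nat \<Rightarrow> ('m::{finite,linorder} \<times> 'n::{finite,linorder}) set) \<Rightarrow> (nat \<Rightarrow> nat) \<Rightarrow> ('m \<times> 'n, 'k::field) mpol set" where
  "block_minors k B r = (\<Union>i\<in>{1..k}. minors_in (r i) (B i))"

definition blockwise_det_ideal ::
  "nat \<Rightarrow> (nat \<Rightarrow> ('m::{finite,linorder} \<times> 'n::{finite,linorder}) set) \<Rightarrow> (nat \<Rightarrow> nat) \<Rightarrow> ('m \<times> 'n, 'k::field) mpol set" where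
  "blockwise_det_ideal k B r = ideal_gen (block_minors k B r)"

end

theory Submission imports Defs begin

text \<open>
  The hypothesis on the blocks keeps leading terms from interfering because divisibility between
  terms of minors is very rigid. Every term of the minor with rows \<open>R\<close> and columns \<open>C\<close> is, up to
  sign, a product of variables from \<open>R \<times> C\<close>, exactly one in each row of \<open>R\<close> and in each column of
  \<open>C\<close> (\<open>keys_minor\<close>). If the product of the diagonal entries of a second submatrix \<open>R' \<times> C'\<close>
  divides it, then these diagonal entries lie in \<open>R \<times> C\<close>; they occupy every row of \<open>R'\<close> and every
  column of \<open>C'\<close> (\<open>diagonal_projections\<close>), so \<open>R' \<subseteq> R\<close> and \<open>C' \<subseteq> C\<close>.

  Now let \<open>R' \<times> C'\<close> lie in a block with minor size \<open>r' = #R' = #C'\<close>. The submatrix of the first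
  minor then meets this block in at least \<open>r'\<close> rows and \<open>r'\<close> columns, so by hypothesis \<open>r'\<close> is the
  degree of that minor, which is \<open>#R = #C\<close>. Equal cardinalities turn the inclusions into
  \<open>R' = R\<close>, \<open>C' = C\<close>, and the two minors coincide. Thus no leading term of one generator divides
  a term of another one. Leading coefficients are \<open>1\<close> because a diagonal order makes the product
  of the diagonal entries, without a sign, the leading term.
\<close>

lemma prod_Var:
  "(\<Prod>i\<in>A. Var (f i) :: ('v, 'k::field) mpol) =
     Poly_Mapping.single (\<Sum>i\<in>A. Poly_Mapping.single (f i) 1) 1"
  by (induction A rule: infinite_finite_induct) (simp_all add: Var_def mult_single)

lemma degree_sum_single:
  fixes f :: "'i \<Rightarrow> 'v::finite" and A :: "'i set"
  defines "t \<equiv> \<Sum>i\<in>A. Poly_Mapping.single (f i) (1::nat)"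
  shows "(\<Sum>v\<in>Poly_Mapping.keys t. Poly_Mapping.lookup t v) = card A"
proof -
  have "(\<Sum>v\<in>Poly_Mapping.keys t. Poly_Mapping.lookup t v) =
          (\<Sum>v\<in>UNIV. Poly_Mapping.lookup t v)"
    by (rule sum.mono_neutral_left) (auto simp: in_keys_iff)
  also have "\<dots> = (\<Sum>v\<in>UNIV. \<Sum>i\<in>A. 1 when f i = v)"
    by (simp add: t_def lookup_sum lookup_single)
  also have "\<dots> = (\<Sum>i\<in>A. \<Sum>v\<in>UNIV. 1 when f i = v)"
    by (rule sum.swap)
  finally show ?thesis
    by (simp add: when_def)
qed

lemma monomial_dvd_term:
  assumes "Poly_Mapping.single u (1::'k::field) dvd Poly_Mapping.single (t :: 'v mon) c"
    and "c \<noteq> 0"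
  shows "Poly_Mapping.keys u \<subseteq> Poly_Mapping.keys t"
proof -
  obtain q where q: "Poly_Mapping.single t c = Poly_Mapping.single u 1 * q"
    using assms(1) by (auto simp: dvd_def)
  have "t \<in> Poly_Mapping.keys (Poly_Mapping.single u 1 * q)"
    using assms(2) q[symmetric] by simp
  then obtain w where "t = u + w"
    using keys_mult[of "Poly_Mapping.single u 1" q] by auto
  then show ?thesis
    by (auto simp: in_keys_iff lookup_add)
qed

lemma nth_sorted_list_in:
  "i < card R \<Longrightarrow> sorted_list_of_set R ! i \<in> (R :: 'a::{finite,linorder} set)"
  by (metis finite length_sorted_list_of_set nth_mem set_sorted_list_of_set)

lemma image_nth_sorted_list:
  "(\<lambda>i. sorted_list_of_set R ! i) ` {..<card R} = (R :: 'a::{finite,linorder} set)"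
  using nth_image[of "card R" "sorted_list_of_set R"] by (simp add: atLeast0LessThan)

text \<open>
  In the Leibniz formula each summand is a single monomial up to sign, and the support of a sum
  lies in the union of the supports of the summands.
\<close>

lemma keys_minor:
  fixes R :: "'m::{finite,linorder} set" and C :: "'n::{finite,linorder} set"
  assumes "card R = card C"
    and "t \<in> Poly_Mapping.keys (minor R C :: ('m \<times> 'n, 'k::field) mpol)"
  obtains p where "p permutes {0..<card R}"
    and "t = (\<Sum>i\<in>{0..<card R}.
               Poly_Mapping.single (sorted_list_of_set R ! i, sorted_list_of_set C ! p i) 1)"
proof -
  define M :: "(nat \<Rightarrow> nat) \<Rightarrow> ('m \<times> 'n) mon" where
    "M p = (\<Sum>i\<in>{0..<card R}.
              Poly_Mapping.single (sorted_list_of_set R ! i, sorted_list_of_set C ! p i) 1)" for p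
  have entry: "(\<Prod>i = 0..<card R. mat (card R) (card C)
          (\<lambda>(i, j). Var (sorted_list_of_set R ! i, sorted_list_of_set C ! j)) $$ (i, p i)) =
        (Poly_Mapping.single (M p) 1 :: ('m \<times> 'n, 'k) mpol)"
    if "p permutes {0..<card R}" for p
    unfolding M_def prod_Var[symmetric]
    using permutes_in_image[OF that] assms(1) by (intro prod.cong) auto
  have "minor R C = (\<Sum>p | p permutes {0..<card R}.
          signof p * (Poly_Mapping.single (M p) 1 :: ('m \<times> 'n, 'k) mpol))"
    unfolding minor_def det_def using assms(1) entry by (auto intro!: sum.cong)
  then have "t \<in> (\<Union>p\<in>{p. p permutes {0..<card R}}.
          Poly_Mapping.keys (signof p * (Poly_Mapping.single (M p) 1 :: ('m \<times> 'n, 'k) mpol)))"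
    using assms(2) keys_sum by fastforce
  then obtain p where "p permutes {0..<card R}"
    and "t \<in> Poly_Mapping.keys (signof p * (Poly_Mapping.single (M p) 1 :: ('m \<times> 'n, 'k) mpol))"
    by blast
  then have "p permutes {0..<card R}" "t = M p"
    by (auto simp: sign_def split: if_splits)
  then show ?thesis
    using that unfolding M_def by blast
qed

lemma keys_minor_subset:
  fixes R :: "'m::{finite,linorder} set" and C :: "'n::{finite,linorder} set"
  assumes "card R = card C"
    and "t \<in> Poly_Mapping.keys (minor R C :: ('m \<times> 'n, 'k::field) mpol)"
  shows "Poly_Mapping.keys t \<subseteq> R \<times> C"
proof -
  obtain p where p: "p permutes {0..<card R}"
    and t: "t = (\<Sum>i\<in>{0..<card R}.
               Poly_Mapping.single (sorted_list_of_set R ! i, sorted_list_of_set C ! p i) 1)"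
    using keys_minor[OF assms] .
  have "Poly_Mapping.keys t \<subseteq>
      (\<lambda>i. (sorted_list_of_set R ! i, sorted_list_of_set C ! p i)) ` {0..<card R}"
    unfolding t using keys_sum by fastforce
  moreover have "p i < card C" if "i < card R" for i
    using permutes_in_image[OF p, of i] that assms(1) by simp
  ultimately show ?thesis
    by (auto dest!: subsetD intro: nth_sorted_list_in)
qed

lemma total_deg_minor:
  fixes R :: "'m::{finite,linorder} set" and C :: "'n::{finite,linorder} set"
  assumes "card R = card C" and "(minor R C :: ('m \<times> 'n, 'k::field) mpol) \<noteq> 0"
  shows "total_deg (minor R C :: ('m \<times> 'n, 'k) mpol) = card R"
proof -
  let ?deg = "\<lambda>t. \<Sum>v\<in>Poly_Mapping.keys t. Poly_Mapping.lookup t v"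
  let ?K = "Poly_Mapping.keys (minor R C :: ('m \<times> 'n, 'k) mpol)"
  have "?deg t = card R" if "t \<in> ?K" for t
    by (rule keys_minor[OF assms(1) that])
      (simp only: degree_sum_single card_atLeastLessThan diff_zero)
  moreover have "?K \<noteq> {}"
    using assms(2) by simp
  ultimately have "?deg ` ?K = {card R}"
    by (simp add: image_constant_conv cong: image_cong)
  then show ?thesis
    unfolding total_deg_def by simp
qed

definition diag_mon :: "'m::{finite,linorder} set \<Rightarrow> 'n::{finite,linorder} set \<Rightarrow> ('m \<times> 'n) mon" where
  "diag_mon R C = (\<Sum>i<card R.
     Poly_Mapping.single (sorted_list_of_set R ! i, sorted_list_of_set C ! i) 1)"

lemma lead_term_minor:
  assumes "diagonal_term_order TYPE('k::field) tord" and "card R = card C"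
  shows "lead_term tord (minor R C :: ('m::{finite,linorder} \<times> 'n::{finite,linorder}, 'k) mpol) =
           Poly_Mapping.single (diag_mon R C) 1"
  using assms unfolding diagonal_term_order_def diag_mon_def by (simp add: prod_Var)

text \<open>
  The leading term is a nonzero monomial, so it determines the leading monomial, as its only key,
  and then the leading coefficient.
\<close>

lemma lead_coef_minor:
  assumes "diagonal_term_order TYPE('k::field) tord" and "card R = card C"
  shows "lead_coef tord (minor R C :: ('m::{finite,linorder} \<times> 'n::{finite,linorder}, 'k) mpol) = 1"
proof -
  let ?g = "minor R C :: ('m \<times> 'n, 'k) mpol"
  have eq: "Poly_Mapping.single (lead_mon tord ?g) (lead_coef tord ?g) =
              Poly_Mapping.single (diag_mon R C) 1"
    using lead_term_minor[OF assms] unfolding lead_term_def .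
  then have "Poly_Mapping.keys (Poly_Mapping.single (lead_mon tord ?g) (lead_coef tord ?g)) =
               {diag_mon R C}"
    by simp
  then have "lead_mon tord ?g = diag_mon R C"
    by (auto split: if_splits)
  then show ?thesis
    using eq by (metis lookup_single_eq)
qed

lemma diag_in_keys_diag_mon:
  assumes "i < card R"
  shows "(sorted_list_of_set R ! i, sorted_list_of_set C ! i) \<in> Poly_Mapping.keys (diag_mon R C)"
  unfolding diag_mon_def in_keys_iff lookup_sum using assms
  by (auto intro!: bexI[of _ i])

text \<open>
  A diagonal meets every row and every column of its submatrix, so projecting the entries it
  shares with a set \<open>S\<close> recovers both index sets.
\<close>

lemma diagonal_projections:
  fixes R :: "'m::{finite,linorder} set" and C :: "'n::{finite,linorder} set"
  assumes "card R = card C" and "Poly_Mapping.keys (diag_mon R C) \<subseteq> S"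
  shows "R \<subseteq> fst ` (S \<inter> R \<times> C)" and "C \<subseteq> snd ` (S \<inter> R \<times> C)"
proof -
  let ?d = "\<lambda>i. (sorted_list_of_set R ! i, sorted_list_of_set C ! i)"
  have d: "?d ` {..<card R} \<subseteq> S \<inter> R \<times> C"
    using assms diag_in_keys_diag_mon[of _ R C] nth_sorted_list_in[of _ R] nth_sorted_list_in[of _ C]
    by fastforce
  have "fst ` ?d ` {..<card R} = R" "snd ` ?d ` {..<card R} = C"
    using image_nth_sorted_list[of R] image_nth_sorted_list[of C] assms(1)
    by (simp_all add: image_image)
  then show "R \<subseteq> fst ` (S \<inter> R \<times> C)" and "C \<subseteq> snd ` (S \<inter> R \<times> C)"
    using image_mono[OF d, of fst] image_mono[OF d, of snd] by simp_all
qed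

theorem corollary4p7:
  fixes k :: nat
    and B :: "nat \<Rightarrow> ('m::{finite,linorder} \<times> 'n::{finite,linorder}) set"
    and r :: "nat \<Rightarrow> nat"
    and tord :: "('m \<times> 'n) mon \<Rightarrow> ('m \<times> 'n) mon \<Rightarrow> bool"
    and G :: "('m \<times> 'n, 'k::field) mpol set"
  assumes "CARD('m) \<le> CARD('n)"
    and "\<And>i. i \<in> {1..k} \<Longrightarrow> diagonal_subset (B i)"
    and "\<And>i. i \<in> {1..k} \<Longrightarrow> 0 < r i"
    and "diagonal_term_order TYPE('k) tord"
    and "G = block_minors k B r"
    and "groebner_basis tord G (blockwise_det_ideal k B r)"
    and "\<And>R C j. \<lbrakk>card R = card C; (minor R C :: ('m \<times> 'n, 'k) mpol) \<in> G;
            j \<in> {1..k}; r j \<noteq> total_deg (minor R C :: ('m \<times> 'n, 'k) mpol)\<rbrakk>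
          \<Longrightarrow> card (fst ` ((R \<times> C) \<inter> B j)) < r j \<or> card (snd ` ((R \<times> C) \<inter> B j)) < r j"
  shows "reduced_groebner_basis tord G (blockwise_det_ideal k B r)"
proof -
  have nondvd: "\<not> lead_term tord h dvd t"
    if "g \<in> G" "h \<in> G - {g}" "t \<in> terms_of g" for g h t
  proof
    assume dvd: "lead_term tord h dvd t"
    obtain R C where RC: "g = minor R C" "card R = card C"
      using \<open>g \<in> G\<close> unfolding assms(5) block_minors_def minors_in_def by fastforce
    obtain j R' C' where j: "j \<in> {1..k}" and RC': "h = minor R' C'"
      and card': "card R' = r j" "card C' = r j" and sub: "R' \<times> C' \<subseteq> B j"
      using \<open>h \<in> G - {g}\<close> unfolding assms(5) block_minors_def minors_in_def by fastforce
    obtain s where s: "s \<in> Poly_Mapping.keys g"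
      and t: "t = Poly_Mapping.single s (Poly_Mapping.lookup g s)"
      using \<open>t \<in> terms_of g\<close> unfolding terms_of_def by blast
    have "Poly_Mapping.keys (diag_mon R' C') \<subseteq> Poly_Mapping.keys s"
      using dvd s lead_term_minor[OF assms(4), of R' C'] card' unfolding t RC'
      by (intro monomial_dvd_term[where c = "Poly_Mapping.lookup g s"]) (auto simp: in_keys_iff)
    also have "\<dots> \<subseteq> R \<times> C"
      using keys_minor_subset[OF RC(2)] s unfolding RC(1) .
    finally have proj: "R' \<subseteq> fst ` (R \<times> C \<inter> R' \<times> C')" "C' \<subseteq> snd ` (R \<times> C \<inter> R' \<times> C')"
      using diagonal_projections[of R' C'] card' by simp_all
    then have "R' \<subseteq> R" "C' \<subseteq> C"
      by auto
    \<comment> \<open>The diagonal of \<open>R' \<times> C'\<close> lies in the block \<open>B j\<close>, so \<open>R \<times> C\<close> meets that block in at least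
      \<open>r j\<close> rows and \<open>r j\<close> columns, against the hypothesis unless \<open>r j\<close> is the degree of \<open>g\<close>.\<close>
    have "R' \<subseteq> fst ` (R \<times> C \<inter> B j)" "C' \<subseteq> snd ` (R \<times> C \<inter> B j)"
      using proj sub by blast+
    then have "r j \<le> card (fst ` (R \<times> C \<inter> B j))" "r j \<le> card (snd ` (R \<times> C \<inter> B j))"
      using card' by (metis card_mono finite)+
    then have "r j = total_deg g"
      using assms(7)[OF RC(2) _ j] \<open>g \<in> G\<close> unfolding RC(1) by fastforce
    \<comment> \<open>The divided term \<open>s\<close> of \<open>g\<close> witnesses that \<open>g\<close> is nonzero.\<close>
    also have "\<dots> = card R"
      using total_deg_minor[OF RC(2)] s unfolding RC(1) by (metis empty_iff keys_zero)
    finally have "R' = R" "C' = C"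
      using \<open>R' \<subseteq> R\<close> \<open>C' \<subseteq> C\<close> card' RC(2) by (simp_all add: card_subset_eq)
    then show False
      using \<open>h \<in> G - {g}\<close> RC(1) RC' by simp
  qed
  have "lead_coef tord g = 1" if "g \<in> G" for g
    using that lead_coef_minor[OF assms(4)]
    unfolding assms(5) block_minors_def minors_in_def by fastforce
  then show ?thesis
    using assms(6) nondvd unfolding reduced_groebner_basis_def by blast
qed

end
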